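(* Let $n\ge2$. A vertex of $G_n$ is simplicial if and only if it is a prime power (that is, of the form $p^a$ with $p$ prime and $a\ge1$). The true-twin classes of simplicial vertices of $G_n$ are the sets \[ \{p,p^2,\ldots,p^a\},\qquad a=\max\{j:p^j\le n\}, \] one class for each prime $p\le n$. Consequently, with $\operatorname{Tw}(v)=\{u:N[u]=N[v]\}$ denoting the true-twin class of $v$, \[ \pi(n)=\sum_{\substack{v\in V(G_n)\\ v\text{ simplicial}}}\frac{1}{|\operatorname{Tw}(v)|}. \]
   Context: $G_n$ is the simple graph with vertex set $V(G_n)=\{2,\ldots,n\}$ in which two distinct vertices $x,y$ are adjacent if and only if $\gcd(x,y)>1$. $N(v)$ is the open neighborhood of $v$ and $N[v]=N(v)\cup\{v\}$ its closed neighborhood. A vertex is simplicial if its open neighborhood induces a clique (an empty neighborhood counts as a clique). Two vertices are true twins if their closed neighborhoods are equal. $\pi(n)$ is the number of primes at most $n$. *)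

theory Defs
  imports "HOL-Number_Theory.Prime_Powers" "Graph_Theory.Pair_Digraph"
begin

text \<open>A simple graph is a \<^locale>\<open>pair_graph\<close>: finite, with a symmetric irreflexive arc relation.\<close>

definition gcd_graph :: "nat \<Rightarrow> nat pair_pre_digraph" where
  "gcd_graph n = \<lparr> pverts = {2..n},
     parcs = {(x, y). x \<in> {2..n} \<and> y \<in> {2..n} \<and> x \<noteq> y \<and> gcd x y > 1} \<rparr>"

lemma pair_graph_gcd_graph: "pair_graph (gcd_graph n)"
proof
  have "parcs (gcd_graph n) \<subseteq> {2..n} \<times> {2..n}"
    by (auto simp: gcd_graph_def)
  then show "finite (parcs (gcd_graph n))"
    by (rule finite_subset) simp
  show "symmetric (with_proj (gcd_graph n))"
    by (auto simp: symmetric_def gcd_graph_def gcd.commute intro!: symI)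
qed (auto simp: gcd_graph_def)

definition open_nbhd :: "'a pair_pre_digraph \<Rightarrow> 'a \<Rightarrow> 'a set" where
  "open_nbhd G v = {u \<in> pverts G. (v, u) \<in> parcs G}"

definition closed_nbhd :: "'a pair_pre_digraph \<Rightarrow> 'a \<Rightarrow> 'a set" where
  "closed_nbhd G v = open_nbhd G v \<union> {v}"

definition clique :: "'a pair_pre_digraph \<Rightarrow> 'a set \<Rightarrow> bool" where
  "clique G S \<longleftrightarrow> S \<subseteq> pverts G \<and> (\<forall>x\<in>S. \<forall>y\<in>S. x \<noteq> y \<longrightarrow> (x, y) \<in> parcs G)"

definition simplicial :: "'a pair_pre_digraph \<Rightarrow> 'a \<Rightarrow> bool" where
  "simplicial G v \<longleftrightarrow> v \<in> pverts G \<and> clique G (open_nbhd G v)"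

definition true_twin_class :: "'a pair_pre_digraph \<Rightarrow> 'a \<Rightarrow> 'a set" where
  "true_twin_class G v = {u \<in> pverts G. closed_nbhd G u = closed_nbhd G v}"

definition prime_pi :: "nat \<Rightarrow> nat" where
  "prime_pi n = card {p. prime p \<and> p \<le> n}"

end

theory Submission
  imports Defs
begin

text \<open>For a prime power the closed neighbourhood consists of the multiples of its prime, so it
  determines that prime, and it is a clique.  If \<open>v\<close> has two distinct prime divisors, these are
  two non-adjacent neighbours of \<open>v\<close>; they also distinguish \<open>v\<close> from every prime power.\<close>

lemma pverts_gcd_graph [simp]: "pverts (gcd_graph n) = {2..n}"
  by (simp add: gcd_graph_def)

lemma parcs_gcd_graph:
  "(x, y) \<in> parcs (gcd_graph n) \<longleftrightarrow> x \<in> {2..n} \<and> y \<in> {2..n} \<and> x \<noteq> y \<and> \<not> coprime x y"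
proof -
  have "gcd x y > 1 \<longleftrightarrow> \<not> coprime x y" if "x \<in> {2..n}"
  proof -
    \<comment> \<open>A gcd of 0 would break the equivalence, being neither 1 nor greater than 1;
      \<open>x \<ge> 2\<close> excludes it.\<close>
    have "gcd x y > 0" using that by auto
    then show ?thesis unfolding coprime_iff_gcd_eq_1 by linarith
  qed
  then show ?thesis by (auto simp: gcd_graph_def)
qed

lemma open_nbhd_gcd_graph:
  "v \<in> {2..n} \<Longrightarrow> open_nbhd (gcd_graph n) v = {u \<in> {2..n}. u \<noteq> v \<and> \<not> coprime v u}"
  by (auto simp: open_nbhd_def parcs_gcd_graph)

lemma closed_nbhd_gcd_graph:
  assumes "v \<in> {2..n}"
  shows "closed_nbhd (gcd_graph n) v = {u \<in> {2..n}. \<not> coprime v u}"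
proof -
  \<comment> \<open>Since \<open>v \<ge> 2\<close>, adding \<open>v\<close> to its open
    neighbourhood amounts to dropping the condition \<open>u \<noteq> v\<close>.\<close>
  have "\<not> coprime v v" using assms by auto
  then show ?thesis using assms by (auto simp: closed_nbhd_def open_nbhd_gcd_graph)
qed

text \<open>A positive exponent does not affect coprimality, and a prime is coprime to exactly the
  numbers that it does not divide. This turns adjacency to a prime power into divisibility.\<close>

lemma not_coprime_primepow_iff:
  fixes v u :: nat
  assumes "primepow v"
  shows "\<not> coprime v u \<longleftrightarrow> aprimedivisor v dvd u"
proof -
  obtain p k where pk: "prime p" "k > 0" "v = p ^ k"
    using assms by (auto simp: primepow_def)
  then have "aprimedivisor v = p" by (simp add: aprimedivisor_prime_power)
  moreover have "coprime p u \<longleftrightarrow> \<not> p dvd u"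
    using pk(1) by (metis coprime_absorb_left not_prime_unit prime_imp_coprime)
  then have "coprime v u \<longleftrightarrow> \<not> p dvd u" using pk by simp
  ultimately show ?thesis by simp
qed

lemma not_primepow_other_prime_factor:
  fixes v :: nat
  assumes "v \<ge> 2" "\<not> primepow v" "prime p"
  obtains q where "prime q" "q \<noteq> p" "q dvd v"
proof -
  have "v \<noteq> p ^ k" for k
    \<comment> \<open>The exponent 0 gives 1, which \<open>v \<ge> 2\<close> excludes; a positive
      exponent would make \<open>v\<close> a prime power.\<close>
    using assms by (cases "k = 0") auto
  then have "\<exists>q\<in>prime_factors v. q \<noteq> p"
    using assms by (intro Ex_other_prime_factor) auto
  then show ?thesis using that by (auto simp: prime_factors_dvd)
qed

lemma simplicial_gcd_graph_iff:
  assumes v: "v \<in> {2..n}"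
  shows "simplicial (gcd_graph n) v \<longleftrightarrow> primepow v"
proof
  assume "primepow v"
  then have adj: "\<not> coprime v u \<longleftrightarrow> aprimedivisor v dvd u" for u
    by (rule not_coprime_primepow_iff)
  have "prime (aprimedivisor v)" using v by (intro prime_aprimedivisor') auto
  then have "\<not> coprime x y" if "aprimedivisor v dvd x" "aprimedivisor v dvd y" for x y
    using that by (meson coprime_common_divisor not_prime_unit)
  then show "simplicial (gcd_graph n) v"
    using v by (auto simp: simplicial_def clique_def open_nbhd_gcd_graph parcs_gcd_graph adj)
next
  assume simp: "simplicial (gcd_graph n) v"
  show "primepow v"
  proof (rule ccontr)
    assume np: "\<not> primepow v"
    obtain p where p: "prime p" "p dvd v" using v prime_factor_nat[of v] by auto
    obtain q where q: "prime q" "q \<noteq> p" "q dvd v"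
      using not_primepow_other_prime_factor[of v p] v np p by auto
    have nbr: "r \<in> open_nbhd (gcd_graph n) v" if r: "prime r" "r dvd v" for r
    proof -
      \<comment> \<open>A prime is a prime power, so a prime divisor of \<open>v\<close> differs
        from \<open>v\<close> and lies in the open neighbourhood.\<close>
      have "r \<noteq> v" using np r by auto
      moreover have "\<not> coprime v r" using r by (meson coprime_common_divisor dvd_refl not_prime_unit)
      moreover have "r \<le> n" using r v dvd_imp_le[of r v] by auto
      ultimately show ?thesis using v prime_ge_2_nat[OF r(1)] by (simp add: open_nbhd_gcd_graph)
    qed
    have "(p, q) \<in> parcs (gcd_graph n)"
      using simp nbr[OF p] nbr[OF q(1,3)] q(2) by (auto simp: simplicial_def clique_def)
    moreover have "coprime p q" using p q by (simp add: primes_coprime)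
    ultimately show False by (simp add: parcs_gcd_graph)
  qed
qed

lemma true_twin_class_primepow:
  assumes v: "v \<in> {2..n}" "primepow v"
  shows "true_twin_class (gcd_graph n) v =
    {u \<in> {2..n}. primepow u \<and> aprimedivisor u = aprimedivisor v}" (is "_ = ?R")
proof (intro equalityI subsetI)
  fix u assume "u \<in> ?R"
  then show "u \<in> true_twin_class (gcd_graph n) v"
    using v by (auto simp: true_twin_class_def closed_nbhd_gcd_graph not_coprime_primepow_iff)
next
  define p where "p = aprimedivisor v"
  have p: "prime p" using v unfolding p_def by (intro prime_aprimedivisor') auto
  fix u assume "u \<in> true_twin_class (gcd_graph n) v"
  then have u: "u \<in> {2..n}" and "closed_nbhd (gcd_graph n) u = closed_nbhd (gcd_graph n) v"
    by (simp_all add: true_twin_class_def)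
  then have "{w \<in> {2..n}. \<not> coprime u w} = {w \<in> {2..n}. p dvd w}"
    using v by (simp only: closed_nbhd_gcd_graph not_coprime_primepow_iff p_def)
  then have eq: "\<not> coprime u w \<longleftrightarrow> p dvd w" if "w \<in> {2..n}" for w
    using that by blast
  \<comment> \<open>The prime divisors of \<open>u\<close> serve as test vertices: \<open>q\<close>
    is in the closed neighbourhood of \<open>u\<close>, hence in that of \<open>v\<close>, so
    \<open>p\<close> divides \<open>q\<close>.\<close>
  have only_p: "q = p" if q: "prime q" "q dvd u" for q
  proof -
    have "q \<in> {2..n}" using q u prime_ge_2_nat dvd_imp_le[of q u] by fastforce
    moreover have "\<not> coprime u q" using q by (meson coprime_common_divisor dvd_refl not_prime_unit)
    ultimately have "p dvd q" using eq by blast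
    then show ?thesis using p q primes_dvd_imp_eq by blast
  qed
  then have "primepow u"
    using not_primepow_other_prime_factor[of u p] u p by (metis atLeastAtMost_iff)
  moreover have "aprimedivisor u = p"
    using u by (intro only_p prime_aprimedivisor' aprimedivisor_dvd') auto
  ultimately show "u \<in> ?R" using u by (simp add: p_def)
qed

text \<open>Links the explicit list of powers with the description of twin classes by
  \<open>aprimedivisor\<close>.\<close>

lemma prime_powers_upto:
  fixes p n :: nat
  assumes p: "prime p" "p \<le> n"
  shows "{p ^ j | j. 1 \<le> j \<and> j \<le> Max {j. p ^ j \<le> n}} =
    {u \<in> {2..n}. primepow u \<and> aprimedivisor u = p}"
proof -
  have p2: "p \<ge> 2" using p prime_ge_2_nat by blast
  let ?J = "{j. p ^ j \<le> n}"
  \<comment> \<open>This bounds the admissible exponents by \<open>n\<close>, so that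
    \<open>Max\<close> is taken over a finite set; the exponent 0 makes it nonempty.\<close>
  have "j < p ^ j" for j
    using p2 by (intro power_gt_expt) simp
  then have "j \<le> n" if "p ^ j \<le> n" for j
    using that less_imp_le order.trans by blast
  then have "?J \<subseteq> {..n}" by blast
  then have fin: "finite ?J" by (rule finite_subset) simp
  have "0 \<in> ?J" using p p2 by simp
  then have "?J \<noteq> {}" by blast
  then have "Max ?J \<in> ?J" by (rule Max_in[OF fin])
  then have Max: "p ^ Max ?J \<le> n" by simp
  \<comment> \<open>As powers of \<open>p\<close> increase, the admissible exponents form an initial
    segment.\<close>
  have Max_iff: "j \<le> Max ?J \<longleftrightarrow> p ^ j \<le> n" for j
  proof
    assume "j \<le> Max ?J"
    then have "p ^ j \<le> p ^ Max ?J" using p2 by (intro power_increasing) auto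
    then show "p ^ j \<le> n" using Max by (rule order.trans)
  qed (use fin in simp)
  have range: "2 \<le> p ^ j" if "j \<ge> 1" for j
    using p2 power_increasing[OF that, of p] by simp
  have "primepow u \<and> aprimedivisor u = p \<longleftrightarrow> (\<exists>j\<ge>1. u = p ^ j)" for u
    using p by (auto simp: aprimedivisor_prime_power primepow_def Suc_le_eq)
  then show ?thesis using range by (auto simp: Max_iff)
qed

theorem proposition18:
  fixes n :: nat
  assumes "n \<ge> 2"
  shows "(\<forall>v \<in> pverts (gcd_graph n). simplicial (gcd_graph n) v \<longleftrightarrow> primepow v) \<and>
    bij_betw (\<lambda>p. {p ^ j | j. 1 \<le> j \<and> j \<le> Max {j. p ^ j \<le> n}})
      {p. prime p \<and> p \<le> n}
      {true_twin_class (gcd_graph n) v | v. simplicial (gcd_graph n) v} \<and>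
    real (prime_pi n) =
      (\<Sum>v \<in> {v \<in> pverts (gcd_graph n). simplicial (gcd_graph n) v}.
         1 / real (card (true_twin_class (gcd_graph n) v)))"
proof -
  let ?G = "gcd_graph n"
  let ?P = "{p. prime p \<and> p \<le> n}"
  \<comment> \<open>\<open>S\<close> is the set of simplicial vertices, and the sets
    \<open>T p\<close> are the fibres of \<open>aprimedivisor\<close> on it. Both the bijection and
    the sum are read off from this partition.\<close>
  define S where "S = {v \<in> {2..n}. primepow v}"
  define T where "T p = {u \<in> S. aprimedivisor u = p}" for p
  have simplicial_iff: "simplicial ?G v \<longleftrightarrow> v \<in> S" for v
    using simplicial_gcd_graph_iff[of v n] by (auto simp: S_def simplicial_def)
  have twin: "true_twin_class ?G v = T (aprimedivisor v)" if "v \<in> S" for v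
    using that true_twin_class_primepow[of v n] by (auto simp: S_def T_def)
  have powers: "{p ^ j | j. 1 \<le> j \<and> j \<le> Max {j. p ^ j \<le> n}} = T p" if "p \<in> ?P" for p
    using that by (simp only: prime_powers_upto mem_Collect_eq T_def S_def conj_assoc)
  have S_prime: "aprimedivisor v \<in> ?P" if "v \<in> S" for v
  proof -
    have "v \<ge> 2" "v \<le> n" using that by (auto simp: S_def)
    then show ?thesis
      using dvd_imp_le[OF aprimedivisor_dvd'[of v]] by (auto intro!: prime_aprimedivisor')
  qed
  \<comment> \<open>Each prime represents its own class. This yields that every \<open>T p\<close>
    is a twin class, that \<open>T\<close> is injective, and that the cardinalities below are
    nonzero.\<close>
  have prime_T: "p \<in> T p" if "p \<in> ?P" for p
    using that prime_ge_2_nat by (auto simp: T_def S_def prime_aprimedivisor aprimedivisor_of_prime)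
  have twin_classes: "{true_twin_class ?G v | v. simplicial ?G v} = T ` ?P"
  proof (intro equalityI subsetI)
    fix X assume "X \<in> T ` ?P"
    then obtain p where p: "p \<in> ?P" "X = T p" by blast
    from p(1) have "p \<in> T p" by (rule prime_T)
    then have "simplicial ?G p" "X = true_twin_class ?G p"
      using p(2) twin[of p] by (simp_all add: simplicial_iff T_def)
    then show "X \<in> {true_twin_class ?G v | v. simplicial ?G v}" by blast
  next
    fix X assume "X \<in> {true_twin_class ?G v | v. simplicial ?G v}"
    then obtain v where "v \<in> S" "X = true_twin_class ?G v" by (auto simp: simplicial_iff)
    then show "X \<in> T ` ?P" using twin[of v] S_prime[of v] by blast
  qed
  have "inj_on T ?P"
  proof (rule inj_onI)
    fix p q assume "p \<in> ?P" "q \<in> ?P" "T p = T q"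
    then have "p \<in> T p" "p \<in> T q" using prime_T by blast+
    then show "p = q" by (simp add: T_def)
  qed
  then have bij: "bij_betw (\<lambda>p. {p ^ j | j. 1 \<le> j \<and> j \<le> Max {j. p ^ j \<le> n}}) ?P
      {true_twin_class ?G v | v. simplicial ?G v}"
    unfolding twin_classes using powers by (subst bij_betw_cong) (auto simp: bij_betw_def)
  have fin: "finite S" "finite ?P" by (auto simp: S_def)
  have "(\<Sum>v\<in>S. 1 / real (card (true_twin_class ?G v))) =
      (\<Sum>v\<in>S. 1 / real (card (T (aprimedivisor v))))"
    using twin by simp
  \<comment> \<open>Group the vertices by their prime; on the fibre over \<open>p\<close> the
    summand is constantly \<open>1 / card (T p)\<close>, so each fibre contributes 1.\<close>
  also have "\<dots> = (\<Sum>p\<in>?P. \<Sum>v\<in>T p. 1 / real (card (T (aprimedivisor v))))"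
    unfolding T_def using fin S_prime by (intro sum.group[symmetric]) auto
  also have "\<dots> = (\<Sum>p\<in>?P. 1)"
  proof (rule sum.cong)
    fix p assume "p \<in> ?P"
    then have "p \<in> T p" by (rule prime_T)
    moreover have "finite (T p)" using fin(1) by (simp add: T_def)
    ultimately have "card (T p) \<noteq> 0" by auto
    moreover have "(\<Sum>v\<in>T p. 1 / real (card (T (aprimedivisor v)))) =
        (\<Sum>v\<in>T p. 1 / real (card (T p)))"
      by (rule sum.cong) (auto simp: T_def)
    ultimately show "(\<Sum>v\<in>T p. 1 / real (card (T (aprimedivisor v)))) = 1" by simp
  qed simp
  also have "\<dots> = real (prime_pi n)" by (simp add: prime_pi_def)
  finally have sum: "real (prime_pi n) = (\<Sum>v\<in>S. 1 / real (card (true_twin_class ?G v)))" ..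
  have "{v \<in> pverts ?G. simplicial ?G v} = S" by (auto simp: simplicial_iff S_def)
  with bij sum show ?thesis
    by (simp add: simplicial_gcd_graph_iff)
qed

end
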